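(* Let $K$ be a finite simplicial complex with a position function $v:K_0\to\mathbb{R}^d$, let $F:\mathcal{D}\to\mathcal{B}$ be a feature map with a labeled decomposition $\hat F:\hat{\mathcal{D}}_K\to\mathcal{B}^{S(K)}$, and let $g:\mathcal{B}\to\mathbb{R}$ be a linear functional. Let $h:\mathbb{R}^m\to\mathbb{R}$ be $g\circ\hat F_\gamma\circ\hat\alpha$ for some $\gamma\in S(K)$, or $g\circ\bar F_\sigma\circ\hat\alpha$ for some $\sigma\in K$, or $g\circ\tilde F_c\circ\hat\alpha$ for some $c\in\mathcal{C}$, with $\hat F,\bar F,\tilde F,\hat\alpha$ as defined in the context. Let $\kappa$ be the Gaussian, triangular, or Epanechnikov kernel on $\mathbb{R}^m$ with some parameter $a>0$, and assume that the integral $(h*\kappa)(w)=\int_{\mathbb{R}^m}h(w-x)\kappa(x)\,dx$ exists for all $w\in\mathbb{R}^m$. Let $w\in\mathbb{R}^m$ be a (parameter for a) weight on $K$, and let $\varepsilon_1,\varepsilon_2,\ldots$ be drawn independently from the distribution with density $\kappa$. Then, as $n\to\infty$, $$\frac1n\sum_{i=1}^nh(w-\varepsilon_i)\to(h*\kappa)(w)$$ almost surely.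
   Context: Chains. $K$ is a finite abstract simplicial complex: a collection of nonempty subsets of a finite set, closed under taking nonempty subsets and containing all singletons; $K_i$ is the set of simplices of cardinality $i+1$. $S(K)$ is the $\mathbb{Z}/2$-vector space with basis $K$; its elements (chains) are identified with subsets of $K$, and $\|\gamma\|_1$ is the number of simplices in $\gamma$. Persistence. For a total order $\le$ on $K$ extending inclusion $\subseteq$ (a linear extension), the boundary matrix $D$ over $\mathbb{Z}/2$ has rows and columns indexed by $K$ in the order $\le$, with $D_{\sigma\tau}=1$ iff $\sigma\subset\tau$ and $|\sigma|=|\tau|-1$. A matrix $R$ is reduced if distinct nonzero columns have different largest row indices of nonzero entries. A persistence algorithm $\mathcal{A}$ assigns to each boundary matrix $D$ a decomposition $R=DV$ with $R$ reduced and $V$ upper triangular with ones on the diagonal. A birth-death pair is a pair $(\sigma,\tau)$ such that $\sigma$ is the largest row index of a nonzero entry in column $\tau$ of $R$. Each birth-death pair has four associated chains: the birth simplex $\sigma$, the death simplex $\tau$, the representative cycle (sum of all $\rho$ with $R_{\rho\tau}\ne0$) and the bounding chain (sum of all $\rho$ with $V_{\rho\tau}\neq0$). Fix one of these four kinds of chain as the label of birth-death pairs. Diagrams. $\mathcal{D}$ is the set of persistence diagrams, i.e. finite formal sums (multisets) $\sum_i(b_i,d_i)$ with $b_i\le d_i$ real. A labeled persistence diagram is a finite formal sum $\sum_i(b_i,d_i,\ell_i)$ with $b_i\le d_i$; $\hat{\mathcal{D}}_K$ is the set of those arising from $K$, including the empty one $0$, with labels in $S(K)$. $\varphi$ is the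 map forgetting labels. Weights. A weight on $K$ is a function $w:K\to\mathbb{R}$ with $w(\sigma)\le w(\tau)$ whenever $\sigma\subseteq\tau$; $W\subseteq\mathbb{R}^K$ is the set of weights. Fix a persistence algorithm $\mathcal{A}$ and a linear extension $\trianglelefteq$ of $\subseteq$. For $w\in W$, order $K$ by: $\sigma\le_w\tau$ iff $w(\sigma)<w(\tau)$, or $w(\sigma)=w(\tau)$ and $\sigma\trianglelefteq\tau$. Then $\hat\alpha(w)=\sum(w(\sigma),w(\tau),\gamma)$, summed over birth-death pairs $(\sigma,\tau)$ obtained by applying $\mathcal{A}$ to $(K,\le_w)$, where $\gamma$ is the label of the pair. Fix $A\subseteq\mathbb{R}^m$ and $\psi:A\to W$; define $\hat\alpha:\mathbb{R}^m\to\hat{\mathcal{D}}_K$ by $\hat\alpha(a)=\hat\alpha(\psi(a))$ for $a\in A$ and $\hat\alpha(a)=0$ (empty diagram) for $a\notin A$. Elements of $\mathbb{R}^m$ are called parameters for weights. Feature maps. $\mathcal{B}$ is a separable real Banach space. A feature map is a function $F:\mathcal{D}\to\mathcal{B}$. A labeled decomposition of $F$ is a map $\hat F=(\hat F_\gamma)_{\gamma\in S(K)}:\hat{\mathcal{D}}_K\to\mathcal{B}^{S(K)}$ with $\sum_{\gamma\in S(K)}\hat F_\gamma(\hat a)=F(\varphi(\hat a))$ for all $\hat a\in\hat{\mathcal{D}}_K$. The simplex distribution is $\bar F:\hat{\mathcal{D}}_K\to\mathcal{B}^K$, $\bar F_\sigma(\hat a)=\sum_{\gamma\ni\sigma}\hat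 F_\gamma(\hat a)/\|\gamma\|_1$ (sum over chains containing $\sigma$). For the position function $v:K_0\to\mathbb{R}^d$ ($d\ge1$), $|\sigma|$ is the convex hull of $v(\sigma)$, $d_\sigma$ is the dimension of $|\sigma|$, and $|K|=\bigcup_\sigma|\sigma|$. Given a partition of $\mathbb{R}^d$ into translates of a half-open cube $[0,s)^d$ ($s>0$), $\mathcal{C}$ is the finite set of translates that meet $|K|$. The pixel/voxel distribution is $\tilde F:\hat{\mathcal{D}}_K\to\mathcal{B}^{\mathcal{C}}$, $\tilde F_c(\hat a)=\sum_{\sigma\in K}\frac{\operatorname{vol}_{d_\sigma}(|\sigma|\cap c)}{\operatorname{vol}_{d_\sigma}(|\sigma|)}\bar F_\sigma(\hat a)$, where $\operatorname{vol}_k$ is $k$-dimensional volume ($\operatorname{vol}_0$ is counting). Kernels on $\mathbb{R}^m$, with $V_m$ the volume of the unit ball and $t_+=\max(t,0)$: Gaussian $\frac{1}{a^m(2\pi)^{m/2}}\exp(-\|x\|^2/(2a^2))$; triangular $\frac{m+1}{a^mV_m}(1-\|x\|/a)_+$; Epanechnikov $\frac{m+2}{2a^mV_m}(1-\|x\|^2/a^2)_+$. Standing convention: $h$ is Borel measurable. *)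

theory Defs
  imports "HOL-Probability.Probability" "HOL-Library.Z2"
begin

section \<open>Complexes and chains\<close>

definition abstract_simplicial_complex :: "'v set set \<Rightarrow> bool" where
  "abstract_simplicial_complex K \<longleftrightarrow>
     (\<exists>X. finite X \<and> K \<subseteq> Pow X - {{}} \<and> (\<forall>x\<in>X. {x} \<in> K) \<and>
          (\<forall>\<sigma>\<in>K. \<forall>\<rho>. \<rho> \<noteq> {} \<and> \<rho> \<subseteq> \<sigma> \<longrightarrow> \<rho> \<in> K))"

text \<open>A chain over the field with two elements is identified with the set of simplices in it;
  the norm of a chain is its cardinality.\<close>

type_synonym 'v chain = "'v set set"

definition chain_space :: "'v set set \<Rightarrow> 'v chain set" where
  "chain_space K = Pow K"


section \<open>Persistence\<close>

definition linear_extension :: "'v set set \<Rightarrow> 'v set rel \<Rightarrow> bool" where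
  "linear_extension K le \<longleftrightarrow>
     linear_order_on K le \<and> (\<forall>\<sigma>\<in>K. \<forall>\<tau>\<in>K. \<sigma> \<subseteq> \<tau> \<longrightarrow> (\<sigma>, \<tau>) \<in> le)"

text \<open>Matrices have rows and columns indexed by the simplices themselves; only entries with
  both indices in the complex matter. The order of the rows and columns is a separate
  relation on the complex.\<close>

type_synonym 'v simplex_matrix = "'v set \<Rightarrow> 'v set \<Rightarrow> bit"

definition boundary_matrix :: "'v set set \<Rightarrow> 'v simplex_matrix" where
  "boundary_matrix K \<sigma> \<tau> =
     (if \<sigma> \<in> K \<and> \<tau> \<in> K \<and> \<sigma> \<subset> \<tau> \<and> card \<sigma> = card \<tau> - 1 then 1 else 0)"

definition largest_row :: "'v set set \<Rightarrow> 'v set rel \<Rightarrow> 'v simplex_matrix \<Rightarrow> 'v set \<Rightarrow> 'v set \<Rightarrow> bool"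
where
  "largest_row K le R \<tau> \<sigma> \<longleftrightarrow>
     \<sigma> \<in> K \<and> R \<sigma> \<tau> \<noteq> 0 \<and> (\<forall>\<rho>\<in>K. R \<rho> \<tau> \<noteq> 0 \<longrightarrow> (\<rho>, \<sigma>) \<in> le)"

text \<open>A zero column has no largest row, so the condition concerns nonzero columns only.\<close>

definition reduced :: "'v set set \<Rightarrow> 'v set rel \<Rightarrow> 'v simplex_matrix \<Rightarrow> bool" where
  "reduced K le R \<longleftrightarrow>
     (\<forall>\<tau>\<in>K. \<forall>\<tau>'\<in>K. \<forall>\<sigma> \<sigma>'. \<tau> \<noteq> \<tau>' \<and> largest_row K le R \<tau> \<sigma> \<and> largest_row K le R \<tau>' \<sigma>' \<longrightarrow> \<sigma> \<noteq> \<sigma>')"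

definition unit_upper_triangular :: "'v set set \<Rightarrow> 'v set rel \<Rightarrow> 'v simplex_matrix \<Rightarrow> bool" where
  "unit_upper_triangular K le U \<longleftrightarrow>
     (\<forall>\<sigma>\<in>K. U \<sigma> \<sigma> = 1) \<and> (\<forall>\<sigma>\<in>K. \<forall>\<tau>\<in>K. U \<sigma> \<tau> \<noteq> 0 \<longrightarrow> (\<sigma>, \<tau>) \<in> le)"

definition reduction :: "'v set set \<Rightarrow> 'v set rel \<Rightarrow> 'v simplex_matrix \<Rightarrow>
    'v simplex_matrix \<times> 'v simplex_matrix \<Rightarrow> bool" where
  "reduction K le D = (\<lambda>(R, U).
     (\<forall>\<sigma>\<in>K. \<forall>\<tau>\<in>K. R \<sigma> \<tau> = (\<Sum>\<rho>\<in>K. D \<sigma> \<rho> * U \<rho> \<tau>)) \<and>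
     reduced K le R \<and> unit_upper_triangular K le U)"

text \<open>The input of an algorithm is a matrix together with the order of its index set; that
  order determines the complex, which is its field.\<close>

type_synonym 'v algorithm =
  "'v set rel \<Rightarrow> 'v simplex_matrix \<Rightarrow> 'v simplex_matrix \<times> 'v simplex_matrix"

definition persistence_algorithm :: "'v algorithm \<Rightarrow> bool" where
  "persistence_algorithm alg \<longleftrightarrow>
     (\<forall>K le. abstract_simplicial_complex K \<and> linear_extension K le \<longrightarrow>
        reduction K le (boundary_matrix K) (alg le (boundary_matrix K)))"

definition birth_death_pairs ::
  "'v set set \<Rightarrow> 'v set rel \<Rightarrow> 'v simplex_matrix \<Rightarrow> ('v set \<times> 'v set) set" where
  "birth_death_pairs K le R = {(\<sigma>, \<tau>). \<tau> \<in> K \<and> largest_row K le R \<tau> \<sigma>}"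

datatype label_kind = Birth_Simplex | Death_Simplex | Representative_Cycle | Bounding_Chain

fun label :: "label_kind \<Rightarrow> 'v set set \<Rightarrow> 'v simplex_matrix \<Rightarrow> 'v simplex_matrix \<Rightarrow>
    'v set \<times> 'v set \<Rightarrow> 'v chain" where
  "label Birth_Simplex K R U (\<sigma>, \<tau>) = {\<sigma>}"
| "label Death_Simplex K R U (\<sigma>, \<tau>) = {\<tau>}"
| "label Representative_Cycle K R U (\<sigma>, \<tau>) = {\<rho>\<in>K. R \<rho> \<tau> \<noteq> 0}"
| "label Bounding_Chain K R U (\<sigma>, \<tau>) = {\<rho>\<in>K. U \<rho> \<tau> \<noteq> 0}"


section \<open>Weights and labeled persistence diagrams\<close>

type_synonym diagram = "(real \<times> real) multiset"
type_synonym 'v labeled_diagram = "(real \<times> real \<times> 'v chain) multiset"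

definition diagrams :: "diagram set" where
  "diagrams = {a. \<forall>(b, d)\<in>#a. b \<le> d}"

definition forget_labels :: "'v labeled_diagram \<Rightarrow> diagram" where
  "forget_labels a = image_mset (\<lambda>(b, d, l). (b, d)) a"

definition weight :: "'v set set \<Rightarrow> ('v set \<Rightarrow> real) \<Rightarrow> bool" where
  "weight K w \<longleftrightarrow> (\<forall>\<sigma>\<in>K. \<forall>\<tau>\<in>K. \<sigma> \<subseteq> \<tau> \<longrightarrow> w \<sigma> \<le> w \<tau>)"

definition weight_order :: "'v set set \<Rightarrow> 'v set rel \<Rightarrow> ('v set \<Rightarrow> real) \<Rightarrow> 'v set rel" where
  "weight_order K ext w =
     {(\<sigma>, \<tau>). \<sigma> \<in> K \<and> \<tau> \<in> K \<and> (w \<sigma> < w \<tau> \<or> w \<sigma> = w \<tau> \<and> (\<sigma>, \<tau>) \<in> ext)}"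

definition weight_diagram ::
  "'v algorithm \<Rightarrow> label_kind \<Rightarrow> 'v set set \<Rightarrow> 'v set rel \<Rightarrow> ('v set \<Rightarrow> real) \<Rightarrow> 'v labeled_diagram"
where
  "weight_diagram alg kind K ext w =
     (let le = weight_order K ext w; (R, U) = alg le (boundary_matrix K)
      in image_mset (\<lambda>(\<sigma>, \<tau>). (w \<sigma>, w \<tau>, label kind K R U (\<sigma>, \<tau>)))
           (mset_set (birth_death_pairs K le R)))"

text \<open>The labeled diagrams arising from a complex, together with the empty one. The kind of
  label is fixed; the algorithm and the linear extension may vary.\<close>

definition labeled_diagrams :: "label_kind \<Rightarrow> 'v set set \<Rightarrow> 'v labeled_diagram set" where
  "labeled_diagrams kind K = insert {#}
     {weight_diagram alg kind K ext w | alg ext w.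
        persistence_algorithm alg \<and> linear_extension K ext \<and> weight K w}"

definition parameter_diagram ::
  "'v algorithm \<Rightarrow> label_kind \<Rightarrow> 'v set set \<Rightarrow> 'v set rel \<Rightarrow> 'p set \<Rightarrow> ('p \<Rightarrow> 'v set \<Rightarrow> real) \<Rightarrow>
    'p \<Rightarrow> 'v labeled_diagram" where
  "parameter_diagram alg kind K ext A \<psi> a =
     (if a \<in> A then weight_diagram alg kind K ext (\<psi> a) else {#})"

lemma linear_extension_weight_order:
  assumes "linear_extension K ext" and "weight K w"
  shows "linear_extension K (weight_order K ext w)"
proof -
  have ext: "linear_order_on K ext" "\<And>\<sigma> \<tau>. \<sigma> \<in> K \<Longrightarrow> \<tau> \<in> K \<Longrightarrow> \<sigma> \<subseteq> \<tau> \<Longrightarrow> (\<sigma>, \<tau>) \<in> ext"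
    using assms(1) by (auto simp: linear_extension_def)
  have "refl_on K ext" and "trans ext" and "antisym ext" and "total_on K ext"
    using ext(1) by (auto simp: order_on_defs)
  have "refl_on K (weight_order K ext w)"
    using \<open>refl_on K ext\<close> by (auto simp: refl_on_def weight_order_def)
  moreover have "trans (weight_order K ext w)"
    using transD[OF \<open>trans ext\<close>] by (intro transI) (auto simp: weight_order_def)
  moreover have "antisym (weight_order K ext w)"
    using antisymD[OF \<open>antisym ext\<close>] by (intro antisymI) (auto simp: weight_order_def)
  moreover have "total_on K (weight_order K ext w)"
    using \<open>total_on K ext\<close> by (auto simp: total_on_def weight_order_def)
  moreover have "weight_order K ext w \<subseteq> K \<times> K"
    by (auto simp: weight_order_def)
  moreover have "(\<sigma>, \<tau>) \<in> weight_order K ext w" if "\<sigma> \<in> K" "\<tau> \<in> K" "\<sigma> \<subseteq> \<tau>" for \<sigma> \<tau>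
    using that ext(2) assms(2) by (force simp: weight_order_def weight_def)
  ultimately show ?thesis
    by (simp add: linear_extension_def order_on_defs)
qed

text \<open>Every labeled diagram arising from a complex is a finite formal sum of triples with
  birth at most death and with a chain of the complex as label.\<close>

lemma labeled_diagrams_wf:
  assumes K: "abstract_simplicial_complex K" and a: "a \<in> labeled_diagrams kind K"
  shows "\<forall>(b, d, l)\<in>#a. b \<le> d \<and> l \<in> chain_space K"
proof (cases "a = {#}")
  case False
  then obtain alg ext w where a: "a = weight_diagram alg kind K ext w"
    and alg: "persistence_algorithm alg" and ext: "linear_extension K ext" and w: "weight K w"
    using a by (auto simp: labeled_diagrams_def)
  define le where "le = weight_order K ext w"
  obtain R U where RU: "alg le (boundary_matrix K) = (R, U)" by fastforce
  have "finite K"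
    using K unfolding abstract_simplicial_complex_def
    by (elim exE conjE) (rule finite_subset[of _ "Pow _ - {{}}"], auto)
  have "reduction K le (boundary_matrix K) (R, U)"
    using alg K linear_extension_weight_order[OF ext w] RU[symmetric]
    by (auto simp: persistence_algorithm_def le_def)
  then have R: "R \<sigma> \<tau> = (\<Sum>\<rho>\<in>K. boundary_matrix K \<sigma> \<rho> * U \<rho> \<tau>)"
    and U: "U \<sigma> \<tau> \<noteq> 0 \<Longrightarrow> (\<sigma>, \<tau>) \<in> le" if "\<sigma> \<in> K" "\<tau> \<in> K" for \<sigma> \<tau>
    using that \<open>reduction K le (boundary_matrix K) (R, U)\<close>
    by (auto simp: reduction_def unit_upper_triangular_def)
  have "w \<sigma> \<le> w \<tau> \<and> \<sigma> \<in> K \<and> \<tau> \<in> K" if "(\<sigma>, \<tau>) \<in> birth_death_pairs K le R" for \<sigma> \<tau>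
  proof -
    have in_K: "\<sigma> \<in> K" "\<tau> \<in> K" and "R \<sigma> \<tau> \<noteq> 0"
      using that by (auto simp: birth_death_pairs_def largest_row_def)
    then have "(\<Sum>\<rho>\<in>K. boundary_matrix K \<sigma> \<rho> * U \<rho> \<tau>) \<noteq> 0"
      using R[OF in_K] by simp
    then obtain \<rho> where "\<rho> \<in> K" "boundary_matrix K \<sigma> \<rho> * U \<rho> \<tau> \<noteq> 0"
      by (rule sum.not_neutral_contains_not_neutral)
    then have \<rho>: "\<rho> \<in> K" "boundary_matrix K \<sigma> \<rho> \<noteq> 0" "U \<rho> \<tau> \<noteq> 0"
      by auto
    then have "\<sigma> \<subseteq> \<rho>" by (auto simp: boundary_matrix_def split: if_splits)
    then have "w \<sigma> \<le> w \<rho>" using w in_K \<rho>(1) by (auto simp: weight_def)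
    moreover have "w \<rho> \<le> w \<tau>"
      using U[OF \<rho>(1) in_K(2) \<rho>(3)] by (auto simp: le_def weight_order_def)
    ultimately show ?thesis using in_K by auto
  qed
  moreover have "finite (birth_death_pairs K le R)"
    by (rule finite_subset[OF _ finite_cartesian_product[OF \<open>finite K\<close> \<open>finite K\<close>]])
       (auto simp: birth_death_pairs_def largest_row_def)
  ultimately show ?thesis
    unfolding a weight_diagram_def le_def[symmetric] RU Let_def
    by (cases kind) (auto simp: chain_space_def split_beta)
qed simp

corollary forget_labels_in_diagrams:
  assumes "abstract_simplicial_complex K" and "a \<in> labeled_diagrams kind K"
  shows "forget_labels a \<in> diagrams"
  using labeled_diagrams_wf[OF assms] by (auto simp: forget_labels_def diagrams_def split_beta)


section \<open>Labeled decompositions of feature maps\<close>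

definition labeled_decomposition ::
  "label_kind \<Rightarrow> 'v set set \<Rightarrow> (diagram \<Rightarrow> 'b::real_vector) \<Rightarrow>
    ('v chain \<Rightarrow> 'v labeled_diagram \<Rightarrow> 'b) \<Rightarrow> bool" where
  "labeled_decomposition kind K F Fhat \<longleftrightarrow>
     (\<forall>a\<in>labeled_diagrams kind K. (\<Sum>\<gamma>\<in>chain_space K. Fhat \<gamma> a) = F (forget_labels a))"

definition simplex_distribution ::
  "'v set set \<Rightarrow> ('v chain \<Rightarrow> 'v labeled_diagram \<Rightarrow> 'b::real_vector) \<Rightarrow>
    'v set \<Rightarrow> 'v labeled_diagram \<Rightarrow> 'b" where
  "simplex_distribution K Fhat \<sigma> a =
     (\<Sum>\<gamma> | \<gamma> \<in> chain_space K \<and> \<sigma> \<in> \<gamma>. Fhat \<gamma> a /\<^sub>R real (card \<gamma>))"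


section \<open>Pixel and voxel distributions\<close>

text \<open>Isometric parametrizations of \<open>k\<close>-dimensional flats. The domain is represented by
  functions on \<open>{..<k}\<close>, the space underlying \<open>Pi\<^sub>M {..<k} (\<lambda>_. lborel)\<close>.\<close>

definition flat_chart :: "nat \<Rightarrow> ((nat \<Rightarrow> real) \<Rightarrow> 'a::euclidean_space) \<Rightarrow> bool" where
  "flat_chart k f \<longleftrightarrow>
     (\<exists>p e. (\<forall>i<k. \<forall>j<k. e i \<bullet> e j = (if i = j then 1 else 0)) \<and>
            f = (\<lambda>x. p + (\<Sum>i<k. x i *\<^sub>R e i)))"

text \<open>The \<open>k\<close>-dimensional volume of a subset of a \<open>k\<close>-dimensional flat is the Lebesgue measure
  of its preimage under a chart of the flat. It does not depend on the chart, because Lebesgue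
  measure is invariant under isometries. For \<open>k = 0\<close> it counts points, because the
  empty product measure is a unit mass at one point. The value is unspecified if the set is not
  contained in such a flat.\<close>

definition flat_volume :: "nat \<Rightarrow> 'a::euclidean_space set \<Rightarrow> real" where
  "flat_volume k S =
     (let f = (SOME f. flat_chart k f \<and> S \<subseteq> range f); M = (\<Pi>\<^sub>M i\<in>{..<k}. lborel)
      in measure M {x \<in> space M. f x \<in> S})"

text \<open>Positions are given on vertices, each identified with the simplex that it spans.\<close>

definition geometric_simplex :: "('v \<Rightarrow> 'a::euclidean_space) \<Rightarrow> 'v set \<Rightarrow> 'a set" where
  "geometric_simplex v \<sigma> = convex hull (v ` \<sigma>)"

definition simplex_dim :: "('v \<Rightarrow> 'a::euclidean_space) \<Rightarrow> 'v set \<Rightarrow> nat" where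
  "simplex_dim v \<sigma> = nat (aff_dim (geometric_simplex v \<sigma>))"

definition geometric_union :: "('v \<Rightarrow> 'a::euclidean_space) \<Rightarrow> 'v set set \<Rightarrow> 'a set" where
  "geometric_union v K = (\<Union>\<sigma>\<in>K. geometric_simplex v \<sigma>)"

definition half_open_cube :: "real \<Rightarrow> (real^'d) set" where
  "half_open_cube s = {x. \<forall>i. 0 \<le> x $ i \<and> x $ i < s}"

definition cube_partition :: "real \<Rightarrow> (real^'d) set set \<Rightarrow> bool" where
  "cube_partition s P \<longleftrightarrow>
     partition_on UNIV P \<and> (\<forall>c\<in>P. \<exists>t. c = (\<lambda>x. t + x) ` half_open_cube s)"

definition cells :: "('v \<Rightarrow> real^'d) \<Rightarrow> 'v set set \<Rightarrow> (real^'d) set set \<Rightarrow> (real^'d) set set" where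
  "cells v K P = {c \<in> P. c \<inter> geometric_union v K \<noteq> {}}"

definition cell_distribution ::
  "('v \<Rightarrow> real^'d) \<Rightarrow> 'v set set \<Rightarrow> ('v chain \<Rightarrow> 'v labeled_diagram \<Rightarrow> 'b::real_vector) \<Rightarrow>
    (real^'d) set \<Rightarrow> 'v labeled_diagram \<Rightarrow> 'b" where
  "cell_distribution v K Fhat c a =
     (\<Sum>\<sigma>\<in>K. (flat_volume (simplex_dim v \<sigma>) (geometric_simplex v \<sigma> \<inter> c) /
              flat_volume (simplex_dim v \<sigma>) (geometric_simplex v \<sigma>)) *\<^sub>R
             simplex_distribution K Fhat \<sigma> a)"


section \<open>Kernels and convolution\<close>

definition gaussian_kernel :: "real \<Rightarrow> real^'m \<Rightarrow> real" where
  "gaussian_kernel a x =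
     1 / (a ^ CARD('m) * (2 * pi) powr (real CARD('m) / 2)) * exp (- (norm x)\<^sup>2 / (2 * a\<^sup>2))"

definition triangular_kernel :: "real \<Rightarrow> real^'m \<Rightarrow> real" where
  "triangular_kernel a x =
     (real CARD('m) + 1) / (a ^ CARD('m) * measure lborel (ball (0 :: real^'m) 1)) *
       max (1 - norm x / a) 0"

definition epanechnikov_kernel :: "real \<Rightarrow> real^'m \<Rightarrow> real" where
  "epanechnikov_kernel a x =
     (real CARD('m) + 2) / (2 * a ^ CARD('m) * measure lborel (ball (0 :: real^'m) 1)) *
       max (1 - (norm x)\<^sup>2 / a\<^sup>2) 0"

definition convolution_at ::
  "('a::euclidean_space \<Rightarrow> real) \<Rightarrow> ('a \<Rightarrow> real) \<Rightarrow> 'a \<Rightarrow> real" where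
  "convolution_at h \<kappa> w = (\<integral>x. h (w - x) * \<kappa> x \<partial>lborel)"

end

theory Submission
  imports Defs
begin

text \<open>The claim is the strong law of large numbers for the variables \<open>X\<^sub>i = h (w - \<epsilon>\<^sub>i)\<close>, which
  are independent, identically distributed and integrable with mean \<open>(h * \<kappa>) (w)\<close>. The strong law
  follows from its one-sided form: if the mean is negative, then the partial sums are almost surely
  bounded above. Let \<open>R\<^sub>n = max {0, S\<^sub>1, \<dots>, S\<^sub>n}\<close> and let \<open>R\<^sub>n'\<close> be the same quantity for the shifted
  sequence, so that \<open>R\<^sub>n\<^sub>+\<^sub>1 = max {0, X\<^sub>0 + R\<^sub>n'}\<close>. As \<open>R\<^sub>n\<close> and \<open>R\<^sub>n'\<close> have the same law and
  \<open>R\<^sub>n \<le> R\<^sub>n\<^sub>+\<^sub>1\<close>, the variable \<open>R\<^sub>n\<^sub>+\<^sub>1 - R\<^sub>n' = max {- R\<^sub>n', X\<^sub>0}\<close> has nonnegative mean. If \<open>R\<^sub>n\<close> were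
  unbounded with positive probability, it would be unbounded almost surely by the zero-one law, and
  dominated convergence would give that \<open>X\<^sub>0\<close> has nonnegative mean.\<close>

section \<open>Maxima of partial sums\<close>

text \<open>Unfolded, this is the largest of the partial sums of length at most \<open>n\<close>,
  the empty sum included. Recursion on the first term instead of the last makes the relation to the
  shifted sequence hold by definition.\<close>

primrec max_partial_sum :: "nat \<Rightarrow> (nat \<Rightarrow> real) \<Rightarrow> real" where
  "max_partial_sum 0 f = 0"
| "max_partial_sum (Suc n) f = max 0 (f 0 + max_partial_sum n (\<lambda>i. f (Suc i)))"

lemma max_partial_sum_nonneg: "0 \<le> max_partial_sum n f"
  by (cases n) auto

lemma max_partial_sum_le_Suc: "max_partial_sum n f \<le> max_partial_sum (Suc n) f"
proof (induction n arbitrary: f)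
  case (Suc n)
  have "max_partial_sum n (\<lambda>i. f (Suc i)) \<le> max_partial_sum (Suc n) (\<lambda>i. f (Suc i))"
    by (rule Suc.IH)
  then show ?case by (simp del: max_partial_sum.simps add: max_partial_sum.simps(2)[of _ f])
qed simp

lemma incseq_max_partial_sum: "incseq (\<lambda>n. max_partial_sum n f)"
  by (intro incseq_SucI max_partial_sum_le_Suc)

lemma sum_le_max_partial_sum: "sum f {..<n} \<le> max_partial_sum n f"
proof (induction n arbitrary: f)
  case (Suc n)
  have "sum f {..<Suc n} = f 0 + (\<Sum>i<n. f (Suc i))"
    by (rule sum.lessThan_Suc_shift)
  also have "\<dots> \<le> f 0 + max_partial_sum n (\<lambda>i. f (Suc i))"
    using Suc.IH by simp
  finally show ?case by simp
qed simp

text \<open>This bound makes the maxima integrable as soon as the single terms are.\<close>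

lemma max_partial_sum_le_sum_abs: "max_partial_sum n f \<le> (\<Sum>i<n. \<bar>f i\<bar>)"
proof (induction n arbitrary: f)
  case (Suc n)
  have "f 0 + max_partial_sum n (\<lambda>i. f (Suc i)) \<le> \<bar>f 0\<bar> + (\<Sum>i<n. \<bar>f (Suc i)\<bar>)"
    using Suc.IH by (intro add_mono) auto
  also have "\<dots> = (\<Sum>i<Suc n. \<bar>f i\<bar>)"
    by (rule sum.lessThan_Suc_shift[symmetric])
  finally show ?case by (simp del: sum.lessThan_Suc add: sum_nonneg)
qed simp

text \<open>A bound for a sequence and a bound for its shift by one are converted into each other
  with the help of the first term, so finitely many terms do not matter. Boundedness is thus a tail
  property.\<close>

lemma bounded_max_partial_sum_shift:
  "(\<exists>c. \<forall>n. max_partial_sum n (\<lambda>i. f (i + k)) \<le> c) \<longleftrightarrow> (\<exists>c. \<forall>n. max_partial_sum n f \<le> c)"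
proof (induction k)
  case (Suc k)
  let ?g = "\<lambda>i. f (i + k)"
  have "(\<exists>c. \<forall>n. max_partial_sum n (\<lambda>i. ?g (Suc i)) \<le> c) \<longleftrightarrow> (\<exists>c. \<forall>n. max_partial_sum n ?g \<le> c)"
  proof safe
    fix c assume c: "\<forall>n. max_partial_sum n (\<lambda>i. ?g (Suc i)) \<le> c"
    have "max_partial_sum n ?g \<le> max 0 (?g 0 + c)" for n
      using order_trans[OF max_partial_sum_le_Suc[of n ?g], of "max 0 (?g 0 + c)"] c[rule_format, of n]
      by simp
    then show "\<exists>c. \<forall>n. max_partial_sum n ?g \<le> c" by blast
  next
    fix c assume c: "\<forall>n. max_partial_sum n ?g \<le> c"
    have "max_partial_sum n (\<lambda>i. ?g (Suc i)) \<le> c - ?g 0" for n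
      using c[rule_format, of "Suc n"] by simp
    then show "\<exists>c. \<forall>n. max_partial_sum n (\<lambda>i. ?g (Suc i)) \<le> c" by blast
  qed
  then show ?case using Suc.IH by simp
qed simp

lemma borel_measurable_max_partial_sum:
  assumes "\<And>i. X i \<in> borel_measurable N"
  shows "(\<lambda>\<omega>. max_partial_sum n (\<lambda>i. X i \<omega>)) \<in> borel_measurable N"
  using assms
proof (induction n arbitrary: X)
  case (Suc n)
  note [measurable] = Suc.prems Suc.IH[of "\<lambda>i. X (Suc i)", OF Suc.prems]
  show ?case by simp
qed simp

section \<open>Independent identically distributed sequences\<close>

lemma (in prob_space) indep_vars_reindex:
  assumes "indep_vars M' X (f ` I)" and inj: "inj_on f I"
  shows "indep_vars (\<lambda>i. M' (f i)) (\<lambda>i. X (f i)) I"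
  unfolding indep_vars_def2 indep_sets_def
proof (intro conjI ballI allI impI)
  let ?F = "\<lambda>i. {X i -` A \<inter> space M | A. A \<in> sets (M' i)}"
  have ind: "indep_sets ?F (f ` I)" and rv: "\<And>i. i \<in> I \<Longrightarrow> random_variable (M' (f i)) (X (f i))"
    using assms(1) by (auto simp: indep_vars_def2)
  show "random_variable (M' (f i)) (X (f i))" if "i \<in> I" for i
    using rv[OF that] .
  show "?F (f i) \<subseteq> events" if "i \<in> I" for i
    using rv[OF that] by auto
  fix J A assume J: "J \<subseteq> I" "J \<noteq> {}" "finite J" and A: "A \<in> Pi J (\<lambda>i. ?F (f i))"
  have injJ: "inj_on f J" using inj J(1) by (rule inj_on_subset)
  define B where "B j = A (the_inv_into J f j)" for j
  have BA: "B (f i) = A i" if "i \<in> J" for i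
    using that by (simp add: B_def the_inv_into_f_f[OF injJ])
  have "prob (\<Inter>j\<in>f ` J. B j) = (\<Prod>j\<in>f ` J. prob (B j))"
  proof (rule indep_setsD[OF ind])
    show "\<forall>j\<in>f ` J. B j \<in> ?F j" using A BA by (auto simp: Pi_iff)
  qed (use J in auto)
  then show "prob (\<Inter>j\<in>J. A j) = (\<Prod>j\<in>J. prob (A j))"
    using BA by (simp add: prod.reindex[OF injJ])
qed

context prob_space
begin

definition iid :: "(nat \<Rightarrow> 'a \<Rightarrow> real) \<Rightarrow> bool" where
  "iid X \<longleftrightarrow> indep_vars (\<lambda>_. borel) X UNIV \<and> (\<forall>i. distr M borel (X i) = distr M borel (X 0))"

lemma iid_indep_vars: "iid X \<Longrightarrow> indep_vars (\<lambda>_. borel) X UNIV"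
  unfolding iid_def by blast

lemma iid_measurable: "iid X \<Longrightarrow> X i \<in> borel_measurable M"
  using iid_indep_vars[of X] by (auto simp: indep_vars_def)

lemma iid_distr: "iid X \<Longrightarrow> distr M borel (X i) = distr M borel (X 0)"
  unfolding iid_def by blast

text \<open>Integrability depends only on the law: on the image measure the variable becomes the
  identity.\<close>

lemma iid_integrable:
  assumes X: "iid X" and "integrable M (X 0)"
  shows "integrable M (X i)"
proof -
  note [measurable] = iid_measurable[OF X]
  have "integrable (distr M borel (X 0)) (\<lambda>x. x)"
    using assms(2) by (simp add: integrable_distr_eq)
  then have "integrable (distr M borel (X i)) (\<lambda>x. x)"
    unfolding iid_distr[OF X, of i] .
  then show ?thesis by (simp add: integrable_distr_eq)
qed

lemma iid_compose:
  assumes X: "iid X" and f[measurable]: "f \<in> borel_measurable borel"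
  shows "iid (\<lambda>i \<omega>. f (X i \<omega>))"
proof -
  note [measurable] = iid_measurable[OF X]
  have "indep_vars (\<lambda>_. borel) (\<lambda>i \<omega>. f (X i \<omega>)) UNIV"
    by (rule indep_vars_compose2[OF iid_indep_vars[OF X]]) simp
  moreover have "distr M borel (\<lambda>\<omega>. f (X i \<omega>)) = distr (distr M borel (X 0)) borel f" for i
    unfolding iid_distr[OF X, of i, symmetric] by (simp add: distr_distr comp_def)
  ultimately show ?thesis by (simp add: iid_def)
qed

lemma iid_distr_PiM:
  assumes "iid X"
  shows "distr M (\<Pi>\<^sub>M i\<in>UNIV. borel) (\<lambda>\<omega> i. X i \<omega>) = (\<Pi>\<^sub>M i\<in>UNIV. distr M borel (X 0))"
proof -
  have "distr M (\<Pi>\<^sub>M i\<in>UNIV. borel) (\<lambda>\<omega>. \<lambda>i\<in>UNIV. X i \<omega>) = (\<Pi>\<^sub>M i\<in>UNIV. distr M borel (X i))"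
    using iid_indep_vars[OF assms] iid_measurable[OF assms]
    by (intro indep_vars_iff_distr_eq_PiM[THEN iffD1]) auto
  also have "\<dots> = (\<Pi>\<^sub>M i\<in>UNIV. distr M borel (X 0))"
    by (rule PiM_cong[OF refl iid_distr[OF assms]])
  finally show ?thesis by (simp add: restrict_def)
qed

lemma iid_Suc:
  assumes "iid X"
  shows "iid (\<lambda>i. X (Suc i))"
proof -
  have "indep_vars (\<lambda>_. borel) X (Suc ` UNIV)"
    using iid_indep_vars[OF assms] by (rule indep_vars_subset) simp
  from indep_vars_reindex[OF this] have "indep_vars (\<lambda>_. borel) (\<lambda>i. X (Suc i)) UNIV"
    by simp
  then show ?thesis using assms unfolding iid_def by metis
qed

text \<open>The joint law of either sequence is the infinite power of the same marginal law, so a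
  functional of the whole path has the same expectation for both.\<close>

lemma iid_expectation_shift:
  fixes \<phi> :: "(nat \<Rightarrow> real) \<Rightarrow> real"
  assumes X: "iid X" and \<phi>[measurable]: "\<phi> \<in> borel_measurable (\<Pi>\<^sub>M i\<in>UNIV. borel)"
  shows "expectation (\<lambda>\<omega>. \<phi> (\<lambda>i. X (Suc i) \<omega>)) = expectation (\<lambda>\<omega>. \<phi> (\<lambda>i. X i \<omega>))"
proof -
  have *: "expectation (\<lambda>\<omega>. \<phi> (\<lambda>i. Y i \<omega>)) =
      integral\<^sup>L (\<Pi>\<^sub>M i\<in>UNIV. distr M borel (Y 0)) \<phi>" if "iid Y" for Y
  proof -
    have [measurable]: "(\<lambda>\<omega> i. Y i \<omega>) \<in> measurable M (\<Pi>\<^sub>M i\<in>UNIV. borel)"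
      using measurable_restrict[of UNIV Y M "\<lambda>_. borel", OF iid_measurable[OF that]]
      by (simp add: restrict_def)
    show ?thesis
      unfolding iid_distr_PiM[OF that, symmetric] by (rule integral_distr[symmetric]) simp_all
  qed
  have "distr M borel (X (Suc 0)) = distr M borel (X 0)"
    by (rule iid_distr[OF X])
  then show ?thesis
    using *[OF X] *[OF iid_Suc[OF X]] by metis
qed

text \<open>For every \<open>k\<close> the event can be expressed by the terms from index
  \<open>k\<close> on, so it is a tail event and Kolmogorov's zero-one law applies.\<close>

lemma iid_unbounded_zero_one:
  assumes X: "iid X"
  defines "B \<equiv> {\<omega> \<in> space M. \<not> (\<exists>c. \<forall>n. max_partial_sum n (\<lambda>i. X i \<omega>) \<le> c)}"
  shows "prob B = 0 \<or> prob B = 1"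
proof -
  define A where "A i = sigma_sets (space M) {X i -` S \<inter> space M | S. S \<in> sets borel}" for i
  have A: "sigma_algebra (space M) (A i)" for i
    unfolding A_def by (rule sigma_algebra_sigma_sets) auto
  have "indep_sets A UNIV"
    using iid_indep_vars[OF X] unfolding indep_vars_def A_def by blast
  moreover have "B \<in> tail_events A"
    unfolding tail_events_def
  proof
    fix k :: nat
    \<comment> \<open>\<open>N\<close> carries the sigma-algebra generated by the variables from
      index \<open>k\<close> on.\<close>
    define N where "N = sigma (space M) (\<Union>(A ` {k..}))"
    have sub: "\<Union>(A ` {k..}) \<subseteq> Pow (space M)"
      using A by (intro UN_least) (simp add: sigma_algebra_iff2)
    have sets_N: "sets N = sigma_sets (space M) (\<Union>(A ` {k..}))" and [simp]: "space N = space M"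
      using sub by (simp_all add: N_def)
    have X_N: "X (i + k) \<in> borel_measurable N" for i
    proof (rule measurableI)
      fix S :: "real set" assume "S \<in> sets borel"
      then have "X (i + k) -` S \<inter> space M \<in> A (i + k)"
        unfolding A_def by blast
      then have "X (i + k) -` S \<inter> space M \<in> \<Union>(A ` {k..})"
        by auto
      then show "X (i + k) -` S \<inter> space N \<in> sets N"
        by (auto simp: sets_N)
    qed simp
    note [measurable] = borel_measurable_max_partial_sum[of "\<lambda>i. X (i + k)", OF X_N]
    \<comment> \<open>Natural bounds make the existential quantifier countable, as measurability
      requires.\<close>
    have bdd_nat: "(\<exists>c::real. \<forall>n. f n \<le> c) \<longleftrightarrow> (\<exists>c::nat. \<forall>n. f n \<le> real c)"
      for f :: "nat \<Rightarrow> real"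
      by (meson order_trans real_arch_simple)
    have "B = {\<omega> \<in> space N. \<not> (\<exists>c::nat. \<forall>n. max_partial_sum n (\<lambda>i. X (i + k) \<omega>) \<le> real c)}"
      unfolding B_def bdd_nat[symmetric]
      using bounded_max_partial_sum_shift[of "\<lambda>i. X i \<omega>" k for \<omega>] by simp
    also have "\<dots> \<in> sets N" by measurable
    finally show "B \<in> sigma_sets (space M) (\<Union>(A ` {k..}))" by (simp add: sets_N)
  qed
  ultimately show ?thesis
    using kolmogorov_0_1_law[of A B] A by blast
qed

lemma iid_negative_mean_bounded:
  assumes X: "iid X" and int: "integrable M (X 0)" and neg: "expectation (X 0) < 0"
  shows "AE \<omega> in M. \<exists>c. \<forall>n. (\<Sum>i<n. X i \<omega>) \<le> c"
proof -
  define R where "R n \<omega> = max_partial_sum n (\<lambda>i. X i \<omega>)" for n \<omega>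
  define R' where "R' n \<omega> = max_partial_sum n (\<lambda>i. X (Suc i) \<omega>)" for n \<omega>
  define B where "B = {\<omega> \<in> space M. \<not> (\<exists>c. \<forall>n. R n \<omega> \<le> c)}"
  note [measurable] = iid_measurable[OF X]
  have R[measurable]: "R n \<in> borel_measurable M" and R'[measurable]: "R' n \<in> borel_measurable M" for n
    unfolding R_def R'_def by (rule borel_measurable_max_partial_sum, simp)+
  have B[measurable]: "B \<in> events"
  proof -
    have "B = {\<omega> \<in> space M. \<not> (\<exists>c::nat. \<forall>n. R n \<omega> \<le> real c)}"
      unfolding B_def by (auto, meson order_trans real_arch_simple)
    then show ?thesis by simp
  qed
  \<comment> \<open>A general \<open>Y\<close> covers both the sequence and its shift.\<close>
  have int_max: "integrable M (\<lambda>\<omega>. max_partial_sum n (\<lambda>i. Y i \<omega>))"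
    if Y: "iid Y" "integrable M (Y 0)" for Y n
  proof (rule Bochner_Integration.integrable_bound)
    show "integrable M (\<lambda>\<omega>. \<Sum>i<n. \<bar>Y i \<omega>\<bar>)"
      using iid_integrable[OF Y] by auto
    show "(\<lambda>\<omega>. max_partial_sum n (\<lambda>i. Y i \<omega>)) \<in> borel_measurable M"
      by (intro borel_measurable_max_partial_sum iid_measurable Y)
    show "AE \<omega> in M. norm (max_partial_sum n (\<lambda>i. Y i \<omega>)) \<le> norm (\<Sum>i<n. \<bar>Y i \<omega>\<bar>)"
      by (auto simp: max_partial_sum_nonneg intro!: order_trans[OF max_partial_sum_le_sum_abs])
  qed
  have int_R: "integrable M (R n)" and int_R': "integrable M (R' n)" for n
    unfolding R_def R'_def
    by (intro int_max X int iid_Suc[OF X] iid_integrable[OF X int])+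
  have nonneg: "0 \<le> expectation (\<lambda>\<omega>. max (- R' n \<omega>) (X 0 \<omega>))" for n
  proof -
    have "expectation (R' n) = expectation (R n)"
      unfolding R_def R'_def
      by (intro iid_expectation_shift[OF X] borel_measurable_max_partial_sum) simp
    also have "\<dots> \<le> expectation (R (Suc n))"
      by (intro integral_mono int_R) (simp add: R_def max_partial_sum_le_Suc del: max_partial_sum.simps)
    finally have "0 \<le> expectation (\<lambda>\<omega>. R (Suc n) \<omega> - R' n \<omega>)"
      using int_R int_R' by simp
    moreover have "R (Suc n) \<omega> - R' n \<omega> = max (- R' n \<omega>) (X 0 \<omega>)" for \<omega>
      by (simp add: R_def R'_def)
    ultimately show ?thesis by (simp only:)
  qed
  have "prob B \<noteq> 1"
  proof
    assume "prob B = 1"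
    then have AE_B: "AE \<omega> in M. \<omega> \<in> B" by (simp add: AE_in_set_eq_1)
    have "(\<lambda>n. expectation (\<lambda>\<omega>. max (- R' n \<omega>) (X 0 \<omega>))) \<longlonglongrightarrow> expectation (X 0)"
    proof (rule integral_dominated_convergence)
      show "AE \<omega> in M. (\<lambda>n. max (- R' n \<omega>) (X 0 \<omega>)) \<longlonglongrightarrow> X 0 \<omega>"
        using AE_B
      proof eventually_elim
        case (elim \<omega>)
        then have "\<not> (\<exists>c. \<forall>n. R' n \<omega> \<le> c)"
          using bounded_max_partial_sum_shift[of "\<lambda>i. X i \<omega>" 1] by (simp add: B_def R_def R'_def)
        then obtain m where m: "- X 0 \<omega> < R' m \<omega>" by (meson not_le)
        \<comment> \<open>The maxima grow with \<open>n\<close>, so once \<open>R'\<close> exceeds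
          \<open>- X 0 \<omega>\<close> it stays above, and the truncation at
          \<open>- R' n \<omega>\<close> is no longer felt.\<close>
        have "- R' n \<omega> \<le> X 0 \<omega>" if "m \<le> n" for n
          using m incseqD[OF incseq_max_partial_sum that, of "\<lambda>i. X (Suc i) \<omega>"]
          by (simp add: R'_def)
        then have "\<forall>\<^sub>F n in sequentially. max (- R' n \<omega>) (X 0 \<omega>) = X 0 \<omega>"
          by (intro eventually_sequentiallyI[of m]) (rule max_absorb2)
        then show ?case by (rule tendsto_eventually)
      qed
      \<comment> \<open>As \<open>R' n \<omega>\<close> is nonnegative, the maximum equals
        \<open>X 0 \<omega>\<close> if that is nonnegative and lies between
        \<open>X 0 \<omega>\<close> and 0 otherwise.\<close>
      show "AE \<omega> in M. norm (max (- R' n \<omega>) (X 0 \<omega>)) \<le> norm (X 0 \<omega>)" for n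
      proof (rule AE_I2)
        fix \<omega>
        have "0 \<le> R' n \<omega>" by (simp add: R'_def max_partial_sum_nonneg)
        then show "norm (max (- R' n \<omega>) (X 0 \<omega>)) \<le> norm (X 0 \<omega>)" by (auto simp: max_def)
      qed
    qed (use int in auto)
    then have "0 \<le> expectation (X 0)"
      by (rule LIMSEQ_le_const) (use nonneg in blast)
    with neg show False by simp
  qed
  then have "prob B = 0"
    using iid_unbounded_zero_one[OF X] by (auto simp: B_def R_def)
  then have "AE \<omega> in M. \<omega> \<notin> B"
    using prob_eq_0[OF B] by simp
  moreover have "AE \<omega> in M. \<omega> \<in> space M" by (rule AE_space)
  ultimately show ?thesis
  proof eventually_elim
    case (elim \<omega>)
    then obtain c where "\<And>n. R n \<omega> \<le> c" by (auto simp: B_def)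
    then show ?case
      using order_trans[OF sum_le_max_partial_sum] unfolding R_def by blast
  qed
qed

lemma iid_average_upper_bound:
  assumes X: "iid X" and int: "integrable M (X 0)"
  shows "AE \<omega> in M. \<forall>e>0. \<forall>\<^sub>F n in sequentially. (\<Sum>i<n. X i \<omega>) / n < expectation (X 0) + e"
proof -
  define \<mu> where "\<mu> = expectation (X 0)"
  \<comment> \<open>Subtracting the mean and a slack \<open>1 / Suc k\<close> leaves variables of
    mean \<open>- 1 / Suc k\<close>. Taking the slack from a countable set lets one null set serve
    all \<open>k\<close>.\<close>
  have "AE \<omega> in M. \<exists>c. \<forall>n. (\<Sum>i<n. X i \<omega> - \<mu> - 1 / Suc k) \<le> c" for k
  proof (rule iid_negative_mean_bounded)
    show "iid (\<lambda>i \<omega>. X i \<omega> - \<mu> - 1 / Suc k)"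
      by (rule iid_compose[OF X, of "\<lambda>x. x - \<mu> - 1 / Suc k"]) simp
  qed (use int in \<open>simp_all add: prob_space \<mu>_def\<close>)
  then have "AE \<omega> in M. \<forall>k. \<exists>c. \<forall>n. (\<Sum>i<n. X i \<omega> - \<mu> - 1 / Suc k) \<le> c"
    by (simp add: AE_all_countable)
  then show ?thesis
  proof eventually_elim
    case (elim \<omega>)
    show ?case
    proof (intro allI impI)
      fix e :: real assume "e > 0"
      \<comment> \<open>Half of \<open>e\<close> pays for the slack, the other half for
        \<open>c / n\<close>, which vanishes in the limit.\<close>
      then obtain k where k: "1 / Suc k < e / 2"
        using reals_Archimedean[of "e / 2"] by (auto simp: inverse_eq_divide)
      obtain c where c: "\<And>n. (\<Sum>i<n. X i \<omega> - \<mu> - 1 / Suc k) \<le> c"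
        using elim by meson
      have "(\<lambda>n. c / real n) \<longlonglongrightarrow> 0" by (rule lim_const_over_n)
      then have "\<forall>\<^sub>F n in sequentially. c / real n < e / 2"
        using \<open>e > 0\<close> by (intro order_tendstoD) auto
      then show "\<forall>\<^sub>F n in sequentially. (\<Sum>i<n. X i \<omega>) / n < expectation (X 0) + e"
        using eventually_gt_at_top[of 0]
      proof eventually_elim
        case (elim n)
        have "(\<Sum>i<n. X i \<omega>) - real n * (\<mu> + 1 / Suc k) \<le> c"
          using c[of n] by (simp add: sum_subtractf algebra_simps)
        then have "(\<Sum>i<n. X i \<omega>) / n \<le> \<mu> + 1 / Suc k + c / n"
          using \<open>0 < n\<close> by (simp add: field_simps del: of_nat_Suc)
        then show ?case using k elim unfolding \<mu>_def by linarith
      qed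
    qed
  qed
qed

text \<open>The upper bound applied to the negated variables is the matching lower bound.\<close>

theorem strong_law_of_large_numbers:
  assumes X: "iid X" and int: "integrable M (X 0)"
  shows "AE \<omega> in M. (\<lambda>n. (\<Sum>i<n. X i \<omega>) / n) \<longlonglongrightarrow> expectation (X 0)"
proof -
  have "iid (\<lambda>i \<omega>. - X i \<omega>)"
    by (rule iid_compose[OF X]) simp
  from iid_average_upper_bound[OF this] iid_average_upper_bound[OF X int] int
  have "AE \<omega> in M. \<forall>e>0. \<forall>\<^sub>F n in sequentially. - (\<Sum>i<n. X i \<omega>) / n < - expectation (X 0) + e"
    and "AE \<omega> in M. \<forall>e>0. \<forall>\<^sub>F n in sequentially. (\<Sum>i<n. X i \<omega>) / n < expectation (X 0) + e"
    by (simp_all add: sum_negf)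
  then show ?thesis
  proof eventually_elim
    case (elim \<omega>)
    show ?case
      unfolding tendsto_iff
    proof (intro allI impI)
      fix e :: real assume "e > 0"
      show "\<forall>\<^sub>F n in sequentially. dist ((\<Sum>i<n. X i \<omega>) / n) (expectation (X 0)) < e"
        using elim(1)[rule_format, OF \<open>e > 0\<close>] elim(2)[rule_format, OF \<open>e > 0\<close>]
        by eventually_elim (auto simp: dist_real_def)
    qed
  qed
qed

end

section \<open>Sampling from the kernel\<close>

text \<open>Since \<open>ennreal\<close> sends negative reals to 0, nonnegativity is what lets the
  density \<open>ennreal (\<kappa> x)\<close> stand for the kernel itself.\<close>

lemma kernels_nonneg:
  assumes "a > 0"
    and "\<kappa> = gaussian_kernel a \<or> \<kappa> = triangular_kernel a \<or> \<kappa> = epanechnikov_kernel a"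
  shows "0 \<le> \<kappa> x"
  using assms by (auto simp: gaussian_kernel_def triangular_kernel_def epanechnikov_kernel_def)

lemma monte_carlo_convolution:
  fixes h \<kappa> :: "'c::euclidean_space \<Rightarrow> real" and \<epsilon> :: "nat \<Rightarrow> 'a \<Rightarrow> 'c"
  assumes "prob_space M" and h[measurable]: "h \<in> borel_measurable borel"
    and nonneg: "\<And>x. 0 \<le> \<kappa> x"
    and int: "integrable lborel (\<lambda>x. h (w - x) * \<kappa> x)"
    and indep: "prob_space.indep_vars M (\<lambda>_. borel) \<epsilon> {1..}"
    and dens: "\<And>i. i \<ge> 1 \<Longrightarrow> distributed M lborel (\<epsilon> i) (\<lambda>x. ennreal (\<kappa> x))"
  shows "AE \<omega> in M.
    (\<lambda>n. (1 / real n) * (\<Sum>i=1..n. h (w - \<epsilon> i \<omega>))) \<longlonglongrightarrow> convolution_at h \<kappa> w"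
proof -
  interpret prob_space M by fact
  \<comment> \<open>The samples are numbered from 1, the sequence in the strong law from 0.\<close>
  define X where "X i \<omega> = h (w - \<epsilon> (Suc i) \<omega>)" for i \<omega>
  have "indep_vars (\<lambda>_. borel) \<epsilon> (range Suc)"
    using indep by (rule indep_vars_subset) auto
  from indep_vars_reindex[OF this]
  have ind: "indep_vars (\<lambda>_. borel) (\<lambda>i. \<epsilon> (Suc i)) UNIV"
    by simp
  then have [measurable]: "\<epsilon> (Suc i) \<in> borel_measurable M" for i
    by (auto simp: indep_vars_def)
  have "indep_vars (\<lambda>_. borel) X UNIV"
    unfolding X_def by (rule indep_vars_compose2[OF ind, of "\<lambda>_ x. h (w - x)"]) simp
  \<comment> \<open>The right-hand side does not mention \<open>i\<close>, which gives identical
    distribution.\<close>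
  moreover have "distr M borel (X i) = distr (density lborel \<kappa>) borel (\<lambda>x. h (w - x))" for i
  proof -
    have "distr M borel (X i) = distr (distr M lborel (\<epsilon> (Suc i))) borel (\<lambda>x. h (w - x))"
      by (subst distr_distr) (auto simp: X_def[abs_def] comp_def)
    then show ?thesis
      using distributed_distr_eq_density[OF dens[of "Suc i"]] by simp
  qed
  ultimately have iid: "iid X" by (simp add: iid_def)
  have d: "distributed M lborel (\<epsilon> (Suc 0)) (\<lambda>x. ennreal (\<kappa> x))"
    using dens by simp
  have "integrable M (X 0)"
    using distributed_integrable[OF d, of "\<lambda>x. h (w - x)"] int nonneg
    by (simp add: X_def[abs_def] mult.commute)
  moreover have "expectation (X 0) = convolution_at h \<kappa> w"
    using distributed_integral[OF d, of "\<lambda>x. h (w - x)"] nonneg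
    by (simp add: X_def[abs_def] convolution_at_def mult.commute)
  moreover have avg: "(1 / real n) * (\<Sum>i=1..n. h (w - \<epsilon> i \<omega>)) = (\<Sum>i<n. X i \<omega>) / n" for n \<omega>
    by (simp add: X_def sum.atLeast1_atMost_eq)
  ultimately show ?thesis
    unfolding avg using strong_law_of_large_numbers[OF iid] by simp
qed

theorem theorem6p7:
  fixes K :: "'v set set"
    and v :: "'v \<Rightarrow> real^'d"
    and s :: real and P :: "(real^'d) set set"
    and alg :: "'v algorithm" and kind :: label_kind and ext :: "'v set rel"
    and A :: "(real^'m) set" and \<psi> :: "real^'m \<Rightarrow> 'v set \<Rightarrow> real"
    and F :: "diagram \<Rightarrow> 'b::{banach, second_countable_topology}"
    and Fhat :: "'v chain \<Rightarrow> 'v labeled_diagram \<Rightarrow> 'b"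
    and g :: "'b \<Rightarrow> real"
    and h \<kappa> :: "real^'m \<Rightarrow> real"
    and a :: real and w :: "real^'m"
    and M :: "'o measure" and \<epsilon> :: "nat \<Rightarrow> 'o \<Rightarrow> real^'m"
  assumes "abstract_simplicial_complex K"
    and "s > 0" and "cube_partition s P"
    and "persistence_algorithm alg" and "linear_extension K ext"
    and "\<forall>x\<in>A. weight K (\<psi> x)"
    and "labeled_decomposition kind K F Fhat"
    and "linear g"
    and "(\<exists>\<gamma>\<in>chain_space K. h = g \<circ> Fhat \<gamma> \<circ> parameter_diagram alg kind K ext A \<psi>) \<or>
         (\<exists>\<sigma>\<in>K. h = g \<circ> simplex_distribution K Fhat \<sigma> \<circ> parameter_diagram alg kind K ext A \<psi>) \<or>
         (\<exists>c\<in>cells v K P.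
            h = g \<circ> cell_distribution v K Fhat c \<circ> parameter_diagram alg kind K ext A \<psi>)"
    and "h \<in> borel_measurable borel"
    and "a > 0"
    and "\<kappa> = gaussian_kernel a \<or> \<kappa> = triangular_kernel a \<or> \<kappa> = epanechnikov_kernel a"
    and "\<forall>u. integrable lborel (\<lambda>x. h (u - x) * \<kappa> x)"
    and "prob_space M"
    and "prob_space.indep_vars M (\<lambda>_. borel) \<epsilon> {1..}"
    and "\<forall>i\<ge>1. distributed M lborel (\<epsilon> i) (\<lambda>x. ennreal (\<kappa> x))"
  shows "AE \<omega> in M.
    (\<lambda>n. (1 / real n) * (\<Sum>i=1..n. h (w - \<epsilon> i \<omega>))) \<longlonglongrightarrow> convolution_at h \<kappa> w"
  \<comment> \<open>The convolution integral is used at the point \<open>u = w\<close>.\<close>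
  by (rule monte_carlo_convolution)
    (use assms kernels_nonneg[of a \<kappa>] in auto)

end
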